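(* Let $k\ge r\ge 3$ be integers, let $c\ge 1$ be a real number, and let $n$ be an integer with $n\ge\left(\frac{2^r c}{2^r-1}+1\right)k$. Then $$g_{c,r}(n,k)\le c^{r-1}+\frac1c\left(1-\frac{1}{2^{r+1}-2}\right)-\frac{k}{n-k}.$$ Consequently, $$g^k_{c,r}\le c^{r-1}+\frac1c\left(1-\frac{1}{2^{r+1}-2}\right).$$
   Context: An $r$-uniform hypergraph $H$ has a finite vertex set $V(H)$ and an edge set $E(H)$ consisting of $r$-element subsets of $V(H)$; $e(H)=|E(H)|$. A subgraph of $H$ is an $r$-uniform hypergraph $H'$ with $V(H')\subseteq V(H)$, $E(H')\subseteq E(H)$. $H$ is connected if for any $x,y\in V(H)$ there is a sequence $x=a_0,a_1,\dots,a_s=y$ of vertices such that each pair $\{a_{i-1},a_i\}$ is contained in a common edge. Deleting a set of vertices removes these vertices and every edge containing at least one of them. $H$ is $(k+1)$-connected if it has at least $k+2$ vertices and it remains connected after the deletion of any $k$ vertices. $\mathcal{F}_{c,r}(n,k)$ is the family of $n$-vertex $r$-uniform hypergraphs containing no $(k+1)$-connected subgraph on more than $ck+k$ vertices. The surplus is $$f_{c,r}(n,k)=\max_{H\in\mathcal{F}_{c,r}(n,k)}e(H)-\binom{n}{r}+\binom{n-k}{r},$$ the relative surplus is, for $n>k$, $g_{c,r}(n,k)=\dfrac{r!\cdot f_{c,r}(n,k)}{k^{r-1}(n-k)}$, and $g^k_{c,r}:=\lim_{n\to\infty}g_{c,r}(n,k)$ (this limit exists for all $k\ge r\ge2$, $c\ge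 0$). *)

theory Defs
  imports Complex_Main
begin

definition uniform_hypergraph :: "nat \<Rightarrow> 'a set \<Rightarrow> 'a set set \<Rightarrow> bool" where
  "uniform_hypergraph r V E \<longleftrightarrow> finite V \<and> (\<forall>e\<in>E. e \<subseteq> V \<and> card e = r)"

definition hyper_subgraph ::
  "nat \<Rightarrow> 'a set \<Rightarrow> 'a set set \<Rightarrow> 'a set \<Rightarrow> 'a set set \<Rightarrow> bool" where
  "hyper_subgraph r V' E' V E \<longleftrightarrow> uniform_hypergraph r V' E' \<and> V' \<subseteq> V \<and> E' \<subseteq> E"

text \<open>A walk \<open>x = a\<^sub>0, \<dots>, a\<^sub>s = y\<close> whose consecutive vertices share an edge is a chain in the
  reflexive transitive closure; \<open>s = 0\<close> is allowed.\<close>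

definition hyper_connected :: "'a set \<Rightarrow> 'a set set \<Rightarrow> bool" where
  "hyper_connected V E \<longleftrightarrow>
     (\<forall>x\<in>V. \<forall>y\<in>V. (x, y) \<in> {(a, b). \<exists>e\<in>E. {a, b} \<subseteq> e}\<^sup>*)"

definition delete_edges :: "'a set \<Rightarrow> 'a set set \<Rightarrow> 'a set set" where
  "delete_edges S E = {e \<in> E. e \<inter> S = {}}"

text \<open>Note the shift: the parameter \<open>k\<close> stands for \<open>(k + 1)\<close>-connectedness.\<close>

definition Suc_connected :: "nat \<Rightarrow> 'a set \<Rightarrow> 'a set set \<Rightarrow> bool" where
  "Suc_connected k V E \<longleftrightarrow>
     card V \<ge> k + 2 \<and>
     (\<forall>S. S \<subseteq> V \<and> card S = k \<longrightarrow> hyper_connected (V - S) (delete_edges S E))"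

text \<open>Vertices are natural numbers; up to isomorphism this covers all finite hypergraphs.\<close>

definition hyper_family :: "real \<Rightarrow> nat \<Rightarrow> nat \<Rightarrow> nat \<Rightarrow> (nat set \<times> nat set set) set" where
  "hyper_family c r n k =
     {(V, E). uniform_hypergraph r V E \<and> card V = n \<and>
        \<not> (\<exists>V' E'. hyper_subgraph r V' E' V E \<and> Suc_connected k V' E' \<and>
                   real (card V') > c * real k + real k)}"

definition max_edges :: "real \<Rightarrow> nat \<Rightarrow> nat \<Rightarrow> nat \<Rightarrow> nat" where
  "max_edges c r n k = Max {card E |V E. (V, E) \<in> hyper_family c r n k}"

text \<open>The maximum is taken over a finite nonempty set.\<close>

lemma finite_edge_counts: "finite {card E |V E. (V, E) \<in> hyper_family c r n k}"
proof (rule finite_subset)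
  show "{card E |V E. (V, E) \<in> hyper_family c r n k} \<subseteq> {..2 ^ n}"
  proof clarify
    fix V E assume "(V, E) \<in> hyper_family c r n k"
    then have V: "finite V" "card V = n" and "E \<subseteq> Pow V"
      by (auto simp: hyper_family_def uniform_hypergraph_def)
    then have "card E \<le> card (Pow V)" by (intro card_mono) auto
    with V show "card E \<le> 2 ^ n" by (simp add: card_Pow)
  qed
qed simp

lemma edge_counts_nonempty: "{card E |V E. (V, E) \<in> hyper_family c r n k} \<noteq> {}"
proof -
  have "\<not> Suc_connected k V ({} :: nat set set)" if "finite V" for V
  proof
    assume con: "Suc_connected k V ({} :: nat set set)"
    then have card: "card V \<ge> k + 2" by (simp add: Suc_connected_def)
    then obtain S where S: "S \<subseteq> V" "card S = k"
      by (metis add_leD1 obtain_subset_with_card_n)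
    have "card (V - S) \<ge> 2"
      using card S that by (simp add: card_Diff_subset finite_subset)
    then obtain x y where "x \<in> V - S" "y \<in> V - S" "x \<noteq> y"
      by (meson card_2_iff' obtain_subset_with_card_n subsetD)
    moreover have "hyper_connected (V - S) (delete_edges S ({} :: nat set set))"
      using con S by (auto simp: Suc_connected_def)
    ultimately show False
      by (auto simp: hyper_connected_def delete_edges_def)
  qed
  then have "({..<n}, {}) \<in> hyper_family c r n k"
    by (auto simp: hyper_family_def uniform_hypergraph_def hyper_subgraph_def)
  then show ?thesis by blast
qed

text \<open>For \<open>n < k\<close> the subtraction \<open>n - k\<close> in the binomial coefficient truncates; the relative
  surplus is only meaningful for \<open>n > k\<close>.\<close>

definition surplus :: "real \<Rightarrow> nat \<Rightarrow> nat \<Rightarrow> nat \<Rightarrow> real" where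
  "surplus c r n k =
     real (max_edges c r n k) - real (n choose r) + real ((n - k) choose r)"

definition rel_surplus :: "real \<Rightarrow> nat \<Rightarrow> nat \<Rightarrow> nat \<Rightarrow> real" where
  "rel_surplus c r n k =
     fact r * surplus c r n k / (real k ^ (r - 1) * (real n - real k))"

text \<open>\<^const>\<open>lim\<close> is unspecified on divergent sequences, so a bound on this value is only
  provable via convergence, which holds for \<open>k \<ge> r \<ge> 2\<close> and \<open>c \<ge> 0\<close>.\<close>

definition lim_rel_surplus :: "real \<Rightarrow> nat \<Rightarrow> nat \<Rightarrow> real" where
  "lim_rel_surplus c r k = lim (\<lambda>n. rel_surplus c r n k)"

end

theory Submission imports Defs begin

text \<open>An extremal hypergraph on \<open>m + k\<close> vertices with \<open>m > c k\<close> has a separator \<open>S\<close> of size \<open>k\<close>, leaving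
  parts of sizes \<open>a + b = m\<close>. Counting edges relative to all \<open>r\<close>-sets that meet \<open>S\<close>, the surplus
  \<open>f(m)\<close> is at most \<open>f(a) + f(b) + (k choose r)\<close>, since only edges inside \<open>S\<close> are counted
  twice; it is also at most \<open>f(b) + (a choose r)\<close>, by treating the part of size \<open>a\<close> as a clique,
  and symmetrically. An induction on \<open>m\<close> chooses the better bound at every split; parts slightly
  larger than \<open>c k\<close> are the critical ones.

  Conversely, many copies of an extremal hypergraph can be glued along a common \<open>k\<close>-set, all crossing
  \<open>r\<close>-sets that meet this set being added. Hence \<open>f\<close> is superadditive enough for Fekete's argument,
  and the limit exists.\<close>

subsection \<open>Counting edges that meet a separator\<close>

text \<open>For k \<le> n this is the number of r-subsets of an n-set that meet a fixed k-subset, as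
  \<open>card_meeting_sets\<close> confirms. Measured against it, edge counts become nearly additive
  under splitting and gluing along that subset.\<close>

definition baseline :: "nat \<Rightarrow> nat \<Rightarrow> nat \<Rightarrow> real" where
  "baseline r k n = real (n choose r) - real ((n - k) choose r)"

lemma surplus_eq: "surplus c r n k = real (max_edges c r n k) - baseline r k n"
  by (simp add: surplus_def baseline_def)

lemma surplus_ge:
  assumes "(V, E) \<in> hyper_family c r n k"
  shows "real (card E) - baseline r k n \<le> surplus c r n k"
proof -
  have "card E \<le> max_edges c r n k"
    unfolding max_edges_def using assms by (intro Max_ge finite_edge_counts) auto
  then show ?thesis by (simp add: surplus_eq)
qed

lemma surplus_attained:
  obtains V E where "(V, E) \<in> hyper_family c r n k"
    "surplus c r n k = real (card E) - baseline r k n"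
proof -
  have "max_edges c r n k \<in> {card E |V E. (V, E) \<in> hyper_family c r n k}"
    unfolding max_edges_def using finite_edge_counts edge_counts_nonempty by (rule Max_in)
  then show thesis using that by (auto simp: surplus_eq)
qed

lemma hyper_family_finite:
  assumes "(V, E) \<in> hyper_family c r n k"
  shows "finite V" "card V = n" "finite E" "\<And>e. e \<in> E \<Longrightarrow> e \<subseteq> V" "\<And>e. e \<in> E \<Longrightarrow> card e = r"
proof -
  show "finite V" "card V = n" "\<And>e. e \<in> E \<Longrightarrow> e \<subseteq> V" "\<And>e. e \<in> E \<Longrightarrow> card e = r"
    using assms by (auto simp: hyper_family_def uniform_hypergraph_def)
  then show "finite E" by (meson Pow_iff finite_Pow_iff finite_subset subsetI)
qed

lemma hyper_family_mono:
  assumes "(V, E) \<in> hyper_family c r n k" "W \<subseteq> V"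
  shows "(W, E \<inter> Pow W) \<in> hyper_family c r (card W) k"
  using assms unfolding hyper_family_def uniform_hypergraph_def hyper_subgraph_def
  by (auto intro: finite_subset)

definition meeting_sets :: "nat \<Rightarrow> 'a set \<Rightarrow> 'a set \<Rightarrow> 'a set set" where
  "meeting_sets r S V = {e. e \<subseteq> V \<and> card e = r \<and> e \<inter> S \<noteq> {}}"

lemma finite_meeting_sets [simp]: "finite V \<Longrightarrow> finite (meeting_sets r S V)"
  by (rule finite_subset[of _ "Pow V"]) (auto simp: meeting_sets_def)

lemma card_meeting_sets:
  assumes "finite V" "S \<subseteq> V" "card S = k"
  shows "real (card (meeting_sets r S V)) = baseline r k (card V)"
proof -
  let ?N = "\<lambda>X. {e. e \<subseteq> X \<and> card e = r}"
  have eq: "?N V = meeting_sets r S V \<union> ?N (V - S)" by (auto simp: meeting_sets_def)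
  have "card (?N V) = card (meeting_sets r S V) + card (?N (V - S))"
    unfolding eq using assms by (intro card_Un_disjoint) (auto simp: meeting_sets_def)
  moreover have "card (V - S) = card V - k"
    using assms by (simp add: card_Diff_subset finite_subset)
  ultimately show ?thesis
    using assms by (simp add: n_subsets baseline_def)
qed

text \<open>Inclusion-exclusion: the r-sets inside \<open>V1\<close> and those inside
  \<open>V2\<close> overlap exactly in the r-subsets of \<open>S\<close>. All of these meet
  \<open>S\<close> because r > 0, which gives the correction \<open>k choose r\<close>.\<close>

lemma card_crossing_sets:
  assumes fin: "finite V1" "finite V2" and S: "V1 \<inter> V2 = S" "card S = k" and "r > 0"
  shows "real (card {e \<in> meeting_sets r S (V1 \<union> V2). \<not> e \<subseteq> V1 \<and> \<not> e \<subseteq> V2}) =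
    baseline r k (card (V1 \<union> V2)) - baseline r k (card V1) - baseline r k (card V2)
      + real (k choose r)"
proof -
  let ?T = "meeting_sets r S"
  have eq: "{e \<in> ?T (V1 \<union> V2). \<not> e \<subseteq> V1 \<and> \<not> e \<subseteq> V2} = ?T (V1 \<union> V2) - (?T V1 \<union> ?T V2)"
    by (auto simp: meeting_sets_def)
  have "card (?T V1) + card (?T V2) = card (?T V1 \<union> ?T V2) + card (?T V1 \<inter> ?T V2)"
    using fin by (intro card_Un_Int) auto
  moreover have "card (?T V1 \<inter> ?T V2) = card (?T S)"
    using S by (intro arg_cong[of _ _ card]) (auto simp: meeting_sets_def)
  moreover have "real (card (?T S)) = real (k choose r)"
    using card_meeting_sets[of S S k r] S fin \<open>r > 0\<close> by (auto simp: baseline_def binomial_eq_0)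
  moreover have "card (?T (V1 \<union> V2) - (?T V1 \<union> ?T V2)) = card (?T (V1 \<union> V2)) - card (?T V1 \<union> ?T V2)"
    using fin by (intro card_Diff_subset) (auto simp: meeting_sets_def)
  moreover have "card (?T V1 \<union> ?T V2) \<le> card (?T (V1 \<union> V2))"
    using fin by (intro card_mono) (auto simp: meeting_sets_def)
  moreover have "real (card (?T V1)) = baseline r k (card V1)"
    "real (card (?T V2)) = baseline r k (card V2)"
    "real (card (?T (V1 \<union> V2))) = baseline r k (card (V1 \<union> V2))"
    using fin S by (intro card_meeting_sets; auto)+
  ultimately show ?thesis unfolding eq by linarith
qed

subsection \<open>Splitting along a separator\<close>

text \<open>Some deletion of k vertices disconnects a vertex x from a vertex y. \<open>A\<close> is
  the set reachable from x after the deletion, \<open>B\<close> is the rest, and no remaining edge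
  joins them.\<close>

lemma separator_exists:
  assumes "card V \<ge> k + 2" "\<And>e. e \<in> E \<Longrightarrow> e \<subseteq> V" "\<not> Suc_connected k V E"
  obtains S A B where "card S = k" "V = S \<union> A \<union> B" "S \<inter> A = {}" "S \<inter> B = {}" "A \<inter> B = {}"
    "A \<noteq> {}" "B \<noteq> {}" "\<And>e. e \<in> E \<Longrightarrow> e \<inter> S = {} \<Longrightarrow> e \<subseteq> A \<or> e \<subseteq> B"
proof -
  from assms obtain S where S: "S \<subseteq> V" "card S = k"
    and "\<not> hyper_connected (V - S) (delete_edges S E)"
    by (auto simp: Suc_connected_def)
  define R where "R = {(a, b). \<exists>e\<in>delete_edges S E. {a, b} \<subseteq> e}"
  obtain x y where xy: "x \<in> V - S" "y \<in> V - S" "(x, y) \<notin> R\<^sup>*"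
    using \<open>\<not> hyper_connected _ _\<close> by (auto simp: hyper_connected_def R_def)
  define A where "A = {z \<in> V - S. (x, z) \<in> R\<^sup>*}"
  show thesis
  proof (rule that[of S A "V - S - A"])
    fix e assume e: "e \<in> E" "e \<inter> S = {}"
    show "e \<subseteq> A \<or> e \<subseteq> V - S - A"
    proof (rule ccontr)
      assume "\<not> ?thesis"
      then obtain z w where zw: "z \<in> e" "z \<in> A" "w \<in> e" "w \<notin> A"
        using assms(2)[OF e(1)] e by blast
      then have "(z, w) \<in> R" using e by (auto simp: R_def delete_edges_def)
      with zw have "(x, w) \<in> R\<^sup>*" by (auto simp: A_def intro: rtrancl_into_rtrancl)
      then show False using zw e assms(2)[OF e(1)] by (auto simp: A_def)
    qed
  qed (use S xy in \<open>auto simp: A_def\<close>)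
qed

text \<open>The definition deletes exactly k vertices, while \<open>S\<close> may be smaller. So
  \<open>S\<close> is padded to a k-set \<open>T\<close> that spares one vertex x of
  \<open>A\<close> and one vertex y of \<open>B\<close>; a walk from x avoiding \<open>T\<close>
  uses only edges that miss \<open>S\<close> and never leaves \<open>A\<close>.\<close>

lemma separated_not_Suc_connected:
  assumes V: "finite V" "V = S \<union> A \<union> B" "S \<inter> A = {}" "S \<inter> B = {}" "A \<inter> B = {}"
    and "A \<noteq> {}" "B \<noteq> {}" "card S \<le> k"
    and sep: "\<And>e. e \<in> E \<Longrightarrow> e \<inter> S = {} \<Longrightarrow> e \<subseteq> A \<or> e \<subseteq> B"
  shows "\<not> Suc_connected k V E"
proof
  assume con: "Suc_connected k V E"
  obtain x y where xy: "x \<in> A" "y \<in> B" using assms by blast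
  have "card (V - {x, y}) = card V - 2"
    using V xy by (subst card_Diff_subset) (auto simp: card_insert_if)
  moreover have "k + 2 \<le> card V" using con unfolding Suc_connected_def by blast
  ultimately have "k \<le> card (V - {x, y})" by simp
  moreover have "S \<subseteq> V - {x, y}" using V xy by auto
  ultimately obtain T where T: "S \<subseteq> T" "T \<subseteq> V - {x, y}" "card T = k"
    using exists_subset_between[of S k "V - {x, y}"] V \<open>card S \<le> k\<close> by auto
  have "hyper_connected (V - T) (delete_edges T E)"
    using con T by (auto simp: Suc_connected_def)
  then have "(x, y) \<in> {(a, b). \<exists>e\<in>delete_edges T E. {a, b} \<subseteq> e}\<^sup>*"
    using T V xy by (auto simp: hyper_connected_def)
  then have "y \<in> A"
  proof induction
    case (step z w)
    then obtain e where "e \<in> E" "e \<inter> S = {}" "z \<in> e" "w \<in> e"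
      using T by (auto simp: delete_edges_def)
    with sep step.IH V show ?case by blast
  qed (use xy in auto)
  with xy V show False by auto
qed

text \<open>The trivial bound: even the complete hypergraph exceeds the baseline only by the r-sets
  that avoid a fixed k-set.\<close>

lemma surplus_small:
  assumes "real n \<le> c * real k + real k" "k \<le> n"
  shows "surplus c r n k \<le> real ((n - k) choose r)"
proof -
  obtain V E where VE: "(V, E) \<in> hyper_family c r n k"
    "surplus c r n k = real (card E) - baseline r k n" by (rule surplus_attained)
  note fin = hyper_family_finite[OF VE(1)]
  have "card E \<le> card {e. e \<subseteq> V \<and> card e = r}"
    using fin by (intro card_mono) auto
  then show ?thesis using VE(2) fin by (simp add: n_subsets baseline_def)
qed

text \<open>All three bounds come from one separator of one extremal hypergraph, so they hold for
  the same pair \<open>a\<close>, \<open>b\<close> and the best of them can be chosen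
  afterwards.\<close>

lemma surplus_split:
  assumes n: "real (m + k) > c * real k + real k" "m \<ge> 2" and "r > 0"
  obtains a b where "a > 0" "b > 0" "a + b = m"
    "surplus c r (m + k) k \<le> surplus c r (b + k) k + real (a choose r)"
    "surplus c r (m + k) k \<le> surplus c r (a + k) k + real (b choose r)"
    "surplus c r (m + k) k \<le> surplus c r (a + k) k + surplus c r (b + k) k + real (k choose r)"
proof -
  obtain V E where VE: "(V, E) \<in> hyper_family c r (m + k) k"
    "surplus c r (m + k) k = real (card E) - baseline r k (m + k)" by (rule surplus_attained)
  note fin = hyper_family_finite[OF VE(1)]
  \<comment> \<open>The hypergraph is a subgraph of itself on more than ck + k vertices, hence not
    (k+1)-connected.\<close>
  have nc: "\<not> Suc_connected k V E"
  proof -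
    have "uniform_hypergraph r V E" using VE(1) by (auto simp: hyper_family_def)
    then have "hyper_subgraph r V E V E" by (simp add: hyper_subgraph_def)
    moreover have "real (card V) > c * real k + real k" using n(1) fin(2) by simp
    ultimately show ?thesis using VE(1) unfolding hyper_family_def by blast
  qed
  obtain S A B where SAB: "card S = k" "V = S \<union> A \<union> B" "S \<inter> A = {}" "S \<inter> B = {}" "A \<inter> B = {}"
    "A \<noteq> {}" "B \<noteq> {}" and sep: "\<And>e. e \<in> E \<Longrightarrow> e \<inter> S = {} \<Longrightarrow> e \<subseteq> A \<or> e \<subseteq> B"
    using separator_exists[OF _ fin(4) nc] fin(2) n by auto
  have finS: "finite S" "finite A" "finite B" using fin(1) SAB(2) by auto
  have cards: "card (S \<union> A) = card A + k" "card (S \<union> B) = card B + k"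
    using SAB finS by (auto simp: card_Un_disjoint)
  have "card V = card (S \<union> A) + card B"
    unfolding SAB(2) using SAB finS by (intro card_Un_disjoint) auto
  with cards fin have ab: "card A + card B = m" by simp
  \<comment> \<open>Stated for interchangeable parts \<open>P\<close> and \<open>Q\<close>, as it is
    applied in both orders.\<close>
  have one_side: "surplus c r (m + k) k \<le> surplus c r (card Q + k) k + real (card P choose r)"
    if PQ: "V = S \<union> P \<union> Q" "S \<inter> P = {}" "S \<inter> Q = {}" "P \<inter> Q = {}"
      "\<And>e. e \<in> E \<Longrightarrow> e \<inter> S = {} \<Longrightarrow> e \<subseteq> P \<or> e \<subseteq> Q" for P Q
  proof -
    let ?W = "S \<union> Q" and ?T = "meeting_sets r S"
    have finPQ: "finite P" "finite Q" using fin(1) PQ(1) by auto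
    have W: "card ?W = card Q + k" using finPQ finS PQ SAB(1) by (simp add: card_Un_disjoint)
    \<comment> \<open>An edge that misses \<open>S\<close> lies in \<open>P\<close> or in
      \<open>Q\<close>. An edge that meets \<open>S\<close> lies in \<open>S \<union> Q\<close> or
      is among the r-sets that \<open>V\<close> adds to the baseline of \<open>S \<union> Q\<close>.
      Thus only r-subsets of \<open>P\<close> are charged beyond that baseline.\<close>
    have sub: "E \<subseteq> (E \<inter> Pow ?W) \<union> (?T V - ?T ?W) \<union> {e. e \<subseteq> P \<and> card e = r}"
    proof
      fix e assume e: "e \<in> E"
      show "e \<in> (E \<inter> Pow ?W) \<union> (?T V - ?T ?W) \<union> {e. e \<subseteq> P \<and> card e = r}"
      proof (cases "e \<inter> S = {}")
        case True
        with PQ(5)[OF e] e fin(5)[OF e] show ?thesis by blast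
      next
        case False
        with e fin(4,5)[OF e] show ?thesis by (simp add: meeting_sets_def)
      qed
    qed
    have "card E \<le> card ((E \<inter> Pow ?W) \<union> (?T V - ?T ?W) \<union> {e. e \<subseteq> P \<and> card e = r})"
      using sub fin finPQ by (intro card_mono) auto
    also have "\<dots> \<le> card (E \<inter> Pow ?W) + card (?T V - ?T ?W) + card {e. e \<subseteq> P \<and> card e = r}"
      by (meson add_le_mono1 card_Un_le order_trans)
    finally have 1: "card E \<le> card (E \<inter> Pow ?W) + card (?T V - ?T ?W) + (card P choose r)"
      using finPQ by (simp add: n_subsets)
    have "?T ?W \<subseteq> ?T V" using PQ(1) by (auto simp: meeting_sets_def)
    then have "real (card (?T V - ?T ?W)) = real (card (?T V)) - real (card (?T ?W))"
      using fin(1) finPQ finS by (simp add: card_Diff_subset card_mono of_nat_diff)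
    moreover have "real (card (?T V)) = baseline r k (m + k)"
      using card_meeting_sets[of V S k r] fin SAB by auto
    moreover have "real (card (?T ?W)) = baseline r k (card Q + k)"
      using card_meeting_sets[of ?W S k r] finS finPQ SAB(1) W by auto
    moreover have "real (card (E \<inter> Pow ?W)) - baseline r k (card Q + k) \<le> surplus c r (card Q + k) k"
      using surplus_ge[OF hyper_family_mono[OF VE(1)], of ?W] PQ(1) W by auto
    ultimately show ?thesis using 1 VE(2) by linarith
  qed
  show thesis
  proof (rule that[of "card A" "card B"])
    show "surplus c r (m + k) k \<le> surplus c r (card B + k) k + real (card A choose r)"
      by (rule one_side[OF SAB(2-5) sep])
    show "surplus c r (m + k) k \<le> surplus c r (card A + k) k + real (card B choose r)"
    proof (rule one_side)
      show "e \<subseteq> B \<or> e \<subseteq> A" if "e \<in> E" "e \<inter> S = {}" for e using sep[OF that] by blast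
    qed (use SAB in auto)
    let ?M = "{e \<in> meeting_sets r S ((S \<union> A) \<union> (S \<union> B)). \<not> e \<subseteq> S \<union> A \<and> \<not> e \<subseteq> S \<union> B}"
    have V: "(S \<union> A) \<union> (S \<union> B) = V" using SAB by auto
    have sub: "E \<subseteq> (E \<inter> Pow (S \<union> A)) \<union> (E \<inter> Pow (S \<union> B)) \<union> ?M"
    proof
      fix e assume e: "e \<in> E"
      show "e \<in> (E \<inter> Pow (S \<union> A)) \<union> (E \<inter> Pow (S \<union> B)) \<union> ?M"
      proof (cases "e \<inter> S = {}")
        case True
        with sep[OF e] e show ?thesis by blast
      next
        case False
        with e fin(4,5)[OF e] show ?thesis unfolding V by (simp add: meeting_sets_def) blast
      qed
    qed
    have "finite ?M" by (rule finite_subset[of _ "Pow V"]) (use fin(1) V in \<open>auto simp: meeting_sets_def\<close>)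
    then have "card E \<le> card ((E \<inter> Pow (S \<union> A)) \<union> (E \<inter> Pow (S \<union> B)) \<union> ?M)"
      using sub fin by (intro card_mono) auto
    also have "\<dots> \<le> card (E \<inter> Pow (S \<union> A)) + card (E \<inter> Pow (S \<union> B)) + card ?M"
      by (meson add_le_mono1 card_Un_le order_trans)
    finally have "card E \<le> \<dots>" .
    moreover have "real (card ?M) = baseline r k (m + k) - baseline r k (card A + k)
        - baseline r k (card B + k) + real (k choose r)"
      using card_crossing_sets[of "S \<union> A" "S \<union> B" S k r] SAB finS cards fin(2) \<open>r > 0\<close>
      unfolding V by auto
    moreover have "real (card (E \<inter> Pow (S \<union> A))) - baseline r k (card A + k) \<le> surplus c r (card A + k) k"
      using surplus_ge[OF hyper_family_mono[OF VE(1)], of "S \<union> A"] SAB cards by auto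
    moreover have "real (card (E \<inter> Pow (S \<union> B))) - baseline r k (card B + k) \<le> surplus c r (card B + k) k"
      using surplus_ge[OF hyper_family_mono[OF VE(1)], of "S \<union> B"] SAB cards by auto
    ultimately show "surplus c r (m + k) k
        \<le> surplus c r (card A + k) k + surplus c r (card B + k) k + real (k choose r)"
      using VE(2) by linarith
  qed (use ab SAB finS in \<open>auto simp: card_gt_0_iff\<close>)
qed

subsection \<open>The real recursion\<close>

text \<open>Convexity of x^r on the nonnegative reals. With the sum of two sizes fixed, it says that
  shifting mass to the larger one increases the sum of r-th powers.\<close>

lemma power_increment_mono:
  fixes s s' d :: real
  assumes "0 \<le> s" "s \<le> s'" "0 \<le> d"
  shows "(s + d) ^ r - s ^ r \<le> (s' + d) ^ r - s' ^ r"
proof (induction r)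
  case (Suc r)
  have "(s + d) * ((s + d) ^ r - s ^ r) \<le> (s' + d) * ((s' + d) ^ r - s' ^ r)"
    using assms Suc.IH by (intro mult_mono) (auto intro: power_mono)
  moreover have "d * s ^ r \<le> d * s' ^ r"
    using assms by (intro mult_left_mono power_mono) auto
  ultimately show ?case by (simp add: algebra_simps)
qed simp

text \<open>By convexity x^r lies on [1, 2] below the chord through (1, 1) and (2, 2^r).\<close>

lemma one_plus_power_le_chord:
  fixes u :: real
  assumes "0 \<le> u" "u \<le> 1"
  shows "(1 + u) ^ r \<le> 1 + u * (2 ^ r - 1)"
proof (induction r)
  case (Suc r)
  have "(1 + u) ^ Suc r \<le> (1 + u) * (1 + u * (2 ^ r - 1))"
    using assms Suc.IH by (simp add: mult_left_mono)
  moreover have "u * u * (2 ^ r - 1) \<le> u * 1 * (2 ^ r - 1)"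
    using assms by (intro mult_right_mono mult_left_mono) auto
  ultimately show ?case by (simp add: algebra_simps)
qed simp

lemma power_le_base:
  fixes x :: real
  assumes "0 \<le> x" "x \<le> 1" "r > 0"
  shows "x ^ r \<le> x"
  using power_decreasing[of 1 r x] assms by simp

text \<open>In units of \<open>c k\<close> a critical part has size \<open>1 + u\<close> with small \<open>u \<ge> 0\<close>, and \<open>D\<close> is \<open>c ^ r\<close>. If
  \<open>D * u\<close> is small, counting the part as a clique is good enough; otherwise splitting it off is.\<close>

lemma absorb_part:
  fixes D u \<delta> :: real
  assumes "0 \<le> D" "0 \<le> u" "u \<le> 1" "D * u \<le> \<delta>" "\<delta> * (2 ^ r - 1) = 1 / 2"
  shows "D * (1 + u) ^ r \<le> D + 1 / 2"
proof -
  have "D * (1 + u) ^ r \<le> D * (1 + u * (2 ^ r - 1))"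
    using assms by (intro mult_left_mono one_plus_power_le_chord)
  also have "\<dots> = D + D * u * (2 ^ r - 1)" by (simp add: algebra_simps)
  also have "\<dots> \<le> D + \<delta> * (2 ^ r - 1)"
    using assms by (intro add_left_mono mult_right_mono) auto
  finally show ?thesis using assms by simp
qed

text \<open>Since u^r \<le> u^2, the right side exceeds the left by at least D u (1 - u) + u -
  \<delta> (1 + u), which is at least (1 - 2 \<delta>) u. The summand 1 provides the term -1 of the
  linear bound for this part.\<close>

lemma split_off_part:
  fixes D u \<delta> :: real
  assumes "0 \<le> D" "0 \<le> u" "u \<le> 1" "\<delta> < D * u" "\<delta> \<le> 1 / 2" "r \<ge> 2"
  shows "D * (1 + u ^ r) + 1 \<le> (D + 1 - \<delta>) * (1 + u)"
proof -
  have "D * u ^ r \<le> D * u ^ 2"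
    using assms by (intro mult_left_mono power_decreasing) auto
  moreover have "\<delta> * (1 - u) \<le> D * u * (1 - u)"
    using assms by (intro mult_right_mono) auto
  moreover have "0 \<le> (1 - 2 * \<delta>) * u" using assms by auto
  ultimately show ?thesis by (simp add: algebra_simps power2_eq_square)
qed

text \<open>Here \<open>K\<close> is ck, \<open>D\<close> is c^r and \<Phi> is the surplus scaled so
  that doubly counted edges inside the separator cost at most 1. The linear bound carries a term -1
  so that it reproduces itself when two parts are split: -1 - 1 + 1 = -1. Parts too small to satisfy
  it must be absorbed or treated separately.\<close>

lemma split_recursion_bound:
  fixes \<Phi> :: "nat \<Rightarrow> real" and K D \<delta> :: real
  defines "T \<equiv> \<lambda>m. real m / K"
  assumes "K > 0" "D \<ge> 0" "r \<ge> 3" and \<delta>: "\<delta> = 1 / (2 ^ (r + 1) - 2)"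
    and small: "\<And>m. T m \<le> 1 \<Longrightarrow> \<Phi> m \<le> D * T m ^ r"
    and split: "\<And>m. T m > 1 \<Longrightarrow> \<exists>a b. a > 0 \<and> b > 0 \<and> a + b = m \<and>
        \<Phi> m \<le> \<Phi> b + D * T a ^ r \<and> \<Phi> m \<le> \<Phi> a + D * T b ^ r \<and> \<Phi> m \<le> \<Phi> a + \<Phi> b + 1"
    and "T m \<ge> 2 ^ r / (2 ^ r - 1)"
  shows "\<Phi> m \<le> (D + 1 - \<delta>) * T m - 1"
proof -
  define N :: real where "N = 2 ^ r"
  define t0 where "t0 = N / (N - 1)"
  have N: "N \<ge> 8"
    using power_increasing[of 3 r "2::real"] \<open>r \<ge> 3\<close> by (simp add: N_def)
  \<comment> \<open>The source of \<delta>: if D u \<le> \<delta>, the chord estimate makes the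
    clique cost of a part of size 1 + u at most D + 1/2, which is below D + 1 - \<delta>.\<close>
  have \<delta>N: "\<delta> * (N - 1) = 1 / 2" using N by (simp add: \<delta> N_def[symmetric] field_simps)
  have "\<delta> > 0" using N by (simp add: \<delta> N_def[symmetric])
  have "\<delta> * 7 \<le> \<delta> * (N - 1)" using N \<open>\<delta> > 0\<close> by simp
  then have \<delta>14: "\<delta> \<le> 1 / 14" using \<delta>N by simp
  have t0: "1 < t0" "t0 \<le> 2" using N by (auto simp: t0_def field_simps)
  \<comment> \<open>From \<open>t0\<close> on, the target (D + 1 - \<delta>) x - 1 is at least D x,
    so the estimate \<open>lin\<close> can start the induction.\<close>
  have t0_ge: "(1 - \<delta>) * t0 \<ge> 1"
    using N \<delta>N \<delta>14 by (simp add: t0_def pos_le_divide_eq algebra_simps)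
  have T_add: "T (a + b) = T a + T b" for a b by (simp add: T_def add_divide_distrib)
  have T_ge0 [simp]: "T a \<ge> 0" for a using \<open>K > 0\<close> by (simp add: T_def)
  have T_mono: "T a \<le> T b \<longleftrightarrow> a \<le> b" for a b using \<open>K > 0\<close> by (simp add: T_def divide_le_cancel)
  \<comment> \<open>By symmetry \<open>a\<close> is the smaller part; only the bound that absorbs it
    as a clique and the two-part bound are kept.\<close>
  have split': "\<exists>a b. a > 0 \<and> a \<le> b \<and> b < m \<and> T m = T a + T b \<and> T a \<le> T b \<and>
      \<Phi> m \<le> \<Phi> b + D * T a ^ r \<and> \<Phi> m \<le> \<Phi> a + \<Phi> b + 1" if m: "T m > 1" for m
  proof -
    obtain a b where ab: "a > 0" "b > 0" "a + b = m" "\<Phi> m \<le> \<Phi> b + D * T a ^ r"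
      "\<Phi> m \<le> \<Phi> a + D * T b ^ r" "\<Phi> m \<le> \<Phi> a + \<Phi> b + 1"
      using split[OF m] by blast
    show ?thesis
    proof (cases "a \<le> b")
      case True
      then show ?thesis using ab T_add T_mono by (intro exI[of _ a] exI[of _ b]) auto
    next
      case False
      then show ?thesis using ab T_add[of b a] T_mono
        by (intro exI[of _ b] exI[of _ a]) (auto simp: add.commute)
    qed
  qed
  \<comment> \<open>The bound corresponds to the extreme split into a part of size exactly 1 and a
    remainder of size \<open>T m - 1\<close>; convexity shows that no other split is worse.\<close>
  have mid: "\<Phi> m \<le> D * (1 + (T m - 1) ^ r)" if "1 \<le> T m" "T m \<le> 2" for m
    using that
  proof (induction m rule: less_induct)
    case (less m)
    show ?case
    proof (cases "T m = 1")
      case True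
      then show ?thesis using small[of m] \<open>r \<ge> 3\<close> by (simp add: power_0_left)
    next
      case False
      then obtain a b where ab: "a > 0" "b < m" "T m = T a + T b" "T a \<le> T b"
        "\<Phi> m \<le> \<Phi> b + D * T a ^ r"
        using split'[of m] less.prems by auto
      have "\<exists>z. \<Phi> b \<le> D * z \<and> z + T a ^ r \<le> 1 + (T m - 1) ^ r"
      proof (cases "T b \<le> 1")
        case True
        then have "T b ^ r + T a ^ r \<le> 1 + (T m - 1) ^ r"
          using power_increment_mono[of "T m - 1" "T a" "1 - T a" r] ab less.prems by simp
        with small[OF True] show ?thesis by auto
      next
        case False
        have "T b \<le> 2" using ab less.prems T_ge0[of a] by linarith
        then have "\<Phi> b \<le> D * (1 + (T b - 1) ^ r)" using less.IH[of b] ab False by simp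
        \<comment> \<open>Increment monotonicity from base 0 is superadditivity of x^r.\<close>
        moreover have "(T b - 1) ^ r + T a ^ r \<le> (T m - 1) ^ r"
          using power_increment_mono[of 0 "T a" "T b - 1" r] ab False \<open>r \<ge> 3\<close>
          by (simp add: algebra_simps power_0_left)
        ultimately show ?thesis by (intro exI[of _ "1 + (T b - 1) ^ r"]) auto
      qed
      then obtain z where z: "\<Phi> b \<le> D * z" "z + T a ^ r \<le> 1 + (T m - 1) ^ r" by blast
      have "D * (z + T a ^ r) \<le> D * (1 + (T m - 1) ^ r)"
        using z(2) \<open>D \<ge> 0\<close> by (rule mult_left_mono)
      with z(1) ab(5) show ?thesis by (simp add: distrib_left)
    qed
  qed
  have lin: "\<Phi> m \<le> D * T m" if "T m \<le> 2" for m
  proof (cases "T m \<le> 1")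
    case True
    have "D * T m ^ r \<le> D * T m"
      using True \<open>D \<ge> 0\<close> \<open>r \<ge> 3\<close> by (intro mult_left_mono power_le_base) auto
    with small[OF True] show ?thesis by simp
  next
    case False
    then have "D * (1 + (T m - 1) ^ r) \<le> D * (1 + (T m - 1))"
      using that \<open>D \<ge> 0\<close> \<open>r \<ge> 3\<close> by (intro mult_left_mono add_left_mono power_le_base) auto
    with mid[of m] that False show ?thesis by simp
  qed
  show ?thesis
    using \<open>T m \<ge> 2 ^ r / (2 ^ r - 1)\<close> unfolding N_def[symmetric] t0_def[symmetric]
  proof (induction m rule: less_induct)
    case (less m)
    have slack: "(1 - \<delta>) * T m \<ge> 1"
    proof -
      have "(1 - \<delta>) * t0 \<le> (1 - \<delta>) * T m" using less.prems \<delta>14 by (intro mult_left_mono) auto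
      with t0_ge show ?thesis by simp
    qed
    have goal_eq: "(D + 1 - \<delta>) * T m - 1 = D * T m + (1 - \<delta>) * T m - 1"
      by (simp add: algebra_simps)
    show ?case
    proof (cases "T m \<le> 2")
      case True
      with lin[OF True] slack goal_eq show ?thesis by simp
    next
      case False
      then obtain a b where ab: "a > 0" "b < m" "a \<le> b" "T m = T a + T b" "T a \<le> T b"
        and absorb: "\<Phi> m \<le> \<Phi> b + D * T a ^ r" and both: "\<Phi> m \<le> \<Phi> a + \<Phi> b + 1"
        using split'[of m] by auto
      have expand: "(D + 1 - \<delta>) * T m = (D + 1 - \<delta>) * T a + (D + 1 - \<delta>) * T b"
        by (simp add: ab(4) distrib_left)
      have IHb: "\<Phi> b \<le> (D + 1 - \<delta>) * T b - 1" if "t0 \<le> T b"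
        using less.IH ab that by auto
      \<comment> \<open>A smaller part of size at most 1 is absorbed at cost at most
        \<open>D * T a\<close>. If both parts reach \<open>t0\<close>, induction applies to both. In
        between, with size 1 + u, comparing D u with \<delta> decides between absorbing and
        splitting off.\<close>
      consider "T a \<le> 1" | "1 < T a" "T a < t0" | "t0 \<le> T a" by linarith
      then show ?thesis
      proof cases
        case 1
        have "D * T a ^ r \<le> D * T a"
          using 1 \<open>D \<ge> 0\<close> \<open>r \<ge> 3\<close> by (intro mult_left_mono power_le_base) auto
        then have step: "\<Phi> m \<le> \<Phi> b + D * T a" using absorb by simp
        show ?thesis
        proof (cases "t0 \<le> T b")
          case True
          have "D * T a \<le> (D + 1 - \<delta>) * T a" using \<delta>14 by (intro mult_right_mono) auto
          with IHb[OF True] step expand show ?thesis by linarith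
        next
          case False
          then have "\<Phi> b \<le> D * T b" using lin[of b] t0 by simp
          with step slack show ?thesis unfolding goal_eq by (simp add: ab(4) distrib_left)
        qed
      next
        case 2
        define u where "u = T a - 1"
        have u: "0 \<le> u" "u \<le> 1" "T a = 1 + u" using 2 t0 by (auto simp: u_def)
        have da: "\<Phi> a \<le> D * (1 + u ^ r)" using mid[of a] 2 t0 by (simp add: u_def)
        show ?thesis
        proof (cases "D * u \<le> \<delta>")
          case True
          then have "D * T a ^ r \<le> D + 1 / 2"
            using absorb_part[of D u \<delta> r] u \<open>D \<ge> 0\<close> \<delta>N by (simp add: N_def)
          then have step: "\<Phi> m \<le> \<Phi> b + D + 1 / 2" using absorb by simp
          show ?thesis
          proof (cases "t0 \<le> T b")
            case True
            have "D + 1 - \<delta> \<le> (D + 1 - \<delta>) * T a"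
              using 2 \<delta>14 \<open>D \<ge> 0\<close> mult_left_mono[of 1 "T a" "D + 1 - \<delta>"] by simp
            with IHb[OF True] step expand \<delta>14 show ?thesis by linarith
          next
            case False
            then have "\<Phi> b \<le> D * T b" using lin[of b] t0 by simp
            moreover have "D \<le> D * T a"
              using 2 \<open>D \<ge> 0\<close> mult_left_mono[of 1 "T a" D] by simp
            \<comment> \<open>The induction hypothesis does not reach \<open>b\<close>, but
              \<open>T m > 2\<close> makes the target exceed \<open>D * T m\<close> by at least 1 -
              2 \<delta>, more than the needed 1/2.\<close>
            moreover have "2 - 2 * \<delta> \<le> (1 - \<delta>) * T m"
              using \<open>\<not> T m \<le> 2\<close> \<delta>14 mult_left_mono[of 2 "T m" "1 - \<delta>"] by simp
            moreover have "D * T m = D * T a + D * T b" by (simp add: ab(4) distrib_left)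
            ultimately show ?thesis unfolding goal_eq using step \<delta>14 by linarith
          qed
        next
          case False
          then have "D * (1 + u ^ r) + 1 \<le> (D + 1 - \<delta>) * T a"
            using split_off_part[of D u \<delta> r] u \<open>D \<ge> 0\<close> \<delta>14 \<open>r \<ge> 3\<close> by simp
          with da have pa: "\<Phi> a \<le> (D + 1 - \<delta>) * T a - 1" by linarith
          have pb: "\<Phi> b \<le> (D + 1 - \<delta>) * T b - 1"
          proof (cases "t0 \<le> T b")
            case True
            then show ?thesis by (rule IHb)
          next
            \<comment> \<open>The larger part is then also critical. Its excess v is at least u, so
              \<delta> < D v and splitting it off is covered by the same estimate.\<close>
            case b: False
            define v where "v = T b - 1"
            have v: "u \<le> v" "0 \<le> v" "v \<le> 1" "T b = 1 + v"
              using 2 t0 b ab by (auto simp: v_def u_def)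
            have "D * u \<le> D * v" using v \<open>D \<ge> 0\<close> by (intro mult_left_mono) auto
            then have "D * (1 + v ^ r) + 1 \<le> (D + 1 - \<delta>) * T b"
              using split_off_part[of D v \<delta> r] v False \<open>D \<ge> 0\<close> \<delta>14 \<open>r \<ge> 3\<close> by simp
            moreover have "\<Phi> b \<le> D * (1 + v ^ r)" using mid[of b] b v t0 by simp
            ultimately show ?thesis by linarith
          qed
          from pa pb both expand show ?thesis by linarith
        qed
      next
        case 3
        then have "\<Phi> a \<le> (D + 1 - \<delta>) * T a - 1" using less.IH[of a] ab by auto
        moreover have "t0 \<le> T b" using 3 ab by simp
        ultimately show ?thesis using IHb both expand by linarith
      qed
    qed
  qed
qed

section \<open>The linear upper bound for the surplus\<close>

lemma surplus_bound:
  fixes c :: real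
  assumes "k > 0" "r \<ge> 3" "c > 0" "c * real k \<ge> 1"
    and m: "real m \<ge> 2 ^ r * c / (2 ^ r - 1) * real k"
  shows "fact r * surplus c r (m + k) k / real k ^ r
    \<le> (c ^ (r - 1) + (1 / c) * (1 - 1 / (2 ^ (r + 1) - 2))) * (real m / real k) - 1"
proof -
  define \<Phi> where "\<Phi> = (\<lambda>m. fact r * surplus c r (m + k) k / real k ^ r)"
  define T where "T = (\<lambda>m. real m / (c * real k))"
  have choose_le: "fact r * real (a choose r) / real k ^ r \<le> c ^ r * T a ^ r" for a
  proof -
    have "fact r * real (a choose r) \<le> real a ^ r"
      using binomial_fact_pow[of a r] by (metis mult.commute of_nat_fact of_nat_le_iff of_nat_mult of_nat_power)
    then show ?thesis
      using assms by (simp add: T_def power_divide power_mult_distrib divide_right_mono)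
  qed
  \<comment> \<open>The case a = k, where \<open>T k\<close> is 1/c and the powers of c
    cancel.\<close>
  have choose_k: "fact r * real (k choose r) / real k ^ r \<le> 1"
    using choose_le[of k] assms by (simp add: T_def power_divide)
  have scale: "fact r * x / real k ^ r \<le> fact r * y / real k ^ r" if "x \<le> y" for x y :: real
    using that by (intro divide_right_mono mult_left_mono) auto
  have "\<Phi> m \<le> (c ^ r + 1 - 1 / (2 ^ (r + 1) - 2)) * (real m / (c * real k)) - 1"
  proof (rule split_recursion_bound[of "c * real k" "c ^ r" r _ \<Phi> m])
    fix m assume "real m / (c * real k) \<le> 1"
    then have "surplus c r (m + k) k \<le> real (m choose r)"
      using surplus_small[of "m + k" c k r] assms by simp
    from scale[OF this] show "\<Phi> m \<le> c ^ r * (real m / (c * real k)) ^ r"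
      using choose_le[of m] by (simp add: \<Phi>_def T_def)
  next
    fix m assume "real m / (c * real k) > 1"
    then have "real m > c * real k" using assms by simp
    \<comment> \<open>Splitting needs at least k + 2 vertices; \<open>c * real k \<ge> 1\<close>
      guarantees them.\<close>
    moreover from this have "m \<ge> 2" using \<open>c * real k \<ge> 1\<close> by linarith
    ultimately obtain a b where ab: "a > 0" "b > 0" "a + b = m"
      "surplus c r (m + k) k \<le> surplus c r (b + k) k + real (a choose r)"
      "surplus c r (m + k) k \<le> surplus c r (a + k) k + real (b choose r)"
      "surplus c r (m + k) k \<le> surplus c r (a + k) k + surplus c r (b + k) k + real (k choose r)"
      using surplus_split[where m = m and k = k and c = c and r = r] assms by auto
    have "\<Phi> m \<le> \<Phi> b + c ^ r * T a ^ r" "\<Phi> m \<le> \<Phi> a + c ^ r * T b ^ r" "\<Phi> m \<le> \<Phi> a + \<Phi> b + 1"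
      using scale[OF ab(4)] scale[OF ab(5)] scale[OF ab(6)] choose_le[of a] choose_le[of b] choose_k
      by (auto simp: \<Phi>_def distrib_left add_divide_distrib)
    then show "\<exists>a b. a > 0 \<and> b > 0 \<and> a + b = m \<and>
        \<Phi> m \<le> \<Phi> b + c ^ r * (real a / (c * real k)) ^ r \<and>
        \<Phi> m \<le> \<Phi> a + c ^ r * (real b / (c * real k)) ^ r \<and> \<Phi> m \<le> \<Phi> a + \<Phi> b + 1"
      unfolding T_def using ab(1-3) by blast
  next
    show "2 ^ r / (2 ^ r - 1) \<le> real m / (c * real k)"
      using m assms by (simp add: pos_le_divide_eq mult.assoc)
  qed (use assms in auto)
  also have "c ^ r = c * c ^ (r - 1)"
    using assms by (metis power_eq_if not_numeral_le_zero)
  then have "(c ^ r + 1 - 1 / (2 ^ (r + 1) - 2)) * (real m / (c * real k)) =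
      (c ^ (r - 1) + (1 / c) * (1 - 1 / (2 ^ (r + 1) - 2))) * (real m / real k)"
    using assms by (simp add: field_simps)
  finally show ?thesis by (simp add: \<Phi>_def)
qed

subsection \<open>Gluing and convergence\<close>

lemma Suc_connected_image:
  assumes inj: "inj_on f V" and sub: "\<And>e. e \<in> E \<Longrightarrow> e \<subseteq> V" and con: "Suc_connected k V E"
  shows "Suc_connected k (f ` V) ((`) f ` E)"
  unfolding Suc_connected_def
proof (intro conjI allI impI)
  show "card (f ` V) \<ge> k + 2"
    using con inj by (simp add: card_image Suc_connected_def)
  fix T assume T: "T \<subseteq> f ` V \<and> card T = k"
  define S where "S = {v \<in> V. f v \<in> T}"
  have "f ` S = T" using T by (auto simp: S_def)
  moreover have "inj_on f S" using inj by (rule inj_on_subset) (auto simp: S_def)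
  ultimately have "card S = k" using T card_image[of f S] by simp
  then have hc: "hyper_connected (V - S) (delete_edges S E)"
    using con by (auto simp: Suc_connected_def S_def)
  have path: "(f x, f y) \<in> {(a, b). \<exists>e\<in>delete_edges T ((`) f ` E). {a, b} \<subseteq> e}\<^sup>*"
    if "(x, y) \<in> {(a, b). \<exists>e\<in>delete_edges S E. {a, b} \<subseteq> e}\<^sup>*" for x y
    using that
  proof induction
    case (step y z)
    then obtain e where e: "e \<in> E" "e \<inter> S = {}" "y \<in> e" "z \<in> e" by (auto simp: delete_edges_def)
    then have "f ` e \<in> delete_edges T ((`) f ` E)"
      using sub[OF e(1)] by (auto simp: delete_edges_def S_def)
    with e have "(f y, f z) \<in> {(a, b). \<exists>e\<in>delete_edges T ((`) f ` E). {a, b} \<subseteq> e}" by blast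
    with step.IH show ?case by (rule rtrancl_into_rtrancl)
  qed simp
  show "hyper_connected (f ` V - T) (delete_edges T ((`) f ` E))"
    unfolding hyper_connected_def
  proof (intro ballI)
    fix a b assume "a \<in> f ` V - T" "b \<in> f ` V - T"
    then obtain x y where "x \<in> V - S" "y \<in> V - S" "a = f x" "b = f y" by (auto simp: S_def)
    with hc path show "(a, b) \<in> {(a, b). \<exists>e\<in>delete_edges T ((`) f ` E). {a, b} \<subseteq> e}\<^sup>*"
      by (auto simp: hyper_connected_def)
  qed
qed

text \<open>A forbidden subgraph of the image is pulled back along the inverse of \<open>f\<close>.
  This allows extremal hypergraphs to be relabelled so that copies overlap only where
  wanted.\<close>

lemma hyper_family_image:
  assumes inj: "inj_on f V" and VE: "(V, E) \<in> hyper_family c r n k"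
  shows "(f ` V, (`) f ` E) \<in> hyper_family c r n k"
proof -
  note fin = hyper_family_finite[OF VE]
  have uni: "uniform_hypergraph r (f ` V) ((`) f ` E)"
    using fin inj by (auto simp: uniform_hypergraph_def) (metis card_image inj_on_subset)
  have False if sub: "hyper_subgraph r V' E' (f ` V) ((`) f ` E)" and con: "Suc_connected k V' E'"
    and big: "real (card V') > c * real k + real k" for V' E'
  proof -
    define g where "g = inv_into V f"
    have V': "V' \<subseteq> f ` V" and E': "E' \<subseteq> (`) f ` E" and E'V': "\<And>e. e \<in> E' \<Longrightarrow> e \<subseteq> V'"
      and r: "\<And>e. e \<in> E' \<Longrightarrow> card e = r" and "finite V'"
      using sub by (auto simp: hyper_subgraph_def uniform_hypergraph_def)
    have injg: "inj_on g V'" using V' unfolding g_def by (rule inj_on_inv_into)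
    have gf: "g ` f ` e = e" if "e \<subseteq> V" for e
      using that inj by (simp add: g_def inv_into_image_cancel)
    have "Suc_connected k (g ` V') ((`) g ` E')"
      using injg E'V' con by (rule Suc_connected_image)
    moreover have "hyper_subgraph r (g ` V') ((`) g ` E') V E"
      unfolding hyper_subgraph_def uniform_hypergraph_def
    proof (intro conjI ballI)
      show "(`) g ` E' \<subseteq> E"
      proof clarify
        fix e assume "e \<in> E'"
        then obtain e0 where "e0 \<in> E" "e = f ` e0" using E' by auto
        then show "g ` e \<in> E" using gf[OF fin(4)] by simp
      qed
      show "g ` V' \<subseteq> V" using V' by (auto simp: g_def inv_into_into)
      fix e assume "e \<in> (`) g ` E'"
      then obtain e' where e': "e' \<in> E'" "e = g ` e'" by auto
      show "e \<subseteq> g ` V'" using e' E'V' by auto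
      show "card e = r" using e' r E'V' injg by (metis card_image inj_on_subset)
    qed (use \<open>finite V'\<close> in simp)
    moreover have "real (card (g ` V')) > c * real k + real k"
      using big by (simp add: card_image[OF injg])
    ultimately show False using VE unfolding hyper_family_def by blast
  qed
  then show ?thesis
    using uni fin inj by (auto simp: hyper_family_def card_image)
qed

text \<open>All crossing r-sets that meet \<open>S\<close> are added. A (k+1)-connected subgraph
  still lies on one side, since otherwise its at most k vertices in \<open>S\<close> would separate
  it. The last summand of the count is the number of r-subsets of \<open>S\<close> that are not
  edges. Edges inside \<open>S\<close> stay the same, so gluing can be iterated.\<close>

lemma glue_hypergraphs:
  assumes VE1: "(V1, E1) \<in> hyper_family c r n1 k" and VE2: "(V2, E2) \<in> hyper_family c r n2 k"
    and S: "V1 \<inter> V2 = S" "card S = k" and agree: "E1 \<inter> Pow S = E2 \<inter> Pow S" and "r > 0"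
  obtains E where "(V1 \<union> V2, E) \<in> hyper_family c r (n1 + n2 - k) k" "E \<inter> Pow S = E1 \<inter> Pow S"
    "real (card E) - baseline r k (n1 + n2 - k) = real (card E1) - baseline r k n1
      + (real (card E2) - baseline r k n2) + (real (k choose r) - real (card (E1 \<inter> Pow S)))"
proof -
  note fin1 = hyper_family_finite[OF VE1] and fin2 = hyper_family_finite[OF VE2]
  define M where "M = {e \<in> meeting_sets r S (V1 \<union> V2). \<not> e \<subseteq> V1 \<and> \<not> e \<subseteq> V2}"
  define E where "E = E1 \<union> E2 \<union> M"
  have cardV: "card (V1 \<union> V2) = n1 + n2 - k"
    using card_Un_Int[of V1 V2] fin1 fin2 S by simp
  have finM: "finite M"
    unfolding M_def using fin1 fin2 by simp
  have int: "E1 \<inter> E2 = E1 \<inter> Pow S"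
    using agree fin1(4) fin2(4) S(1) by blast
  have "card E = card (E1 \<union> E2) + card M"
    unfolding E_def using finM fin1 fin2 by (intro card_Un_disjoint) (auto simp: M_def)
  moreover have "card E1 + card E2 = card (E1 \<union> E2) + card (E1 \<inter> Pow S)"
    unfolding int[symmetric] using fin1 fin2 by (intro card_Un_Int)
  moreover have "real (card M) = baseline r k (n1 + n2 - k) - baseline r k n1 - baseline r k n2
      + real (k choose r)"
    using card_crossing_sets[of V1 V2 S k r] fin1 fin2 S \<open>r > 0\<close> cardV by (simp add: M_def)
  ultimately have count: "real (card E) - baseline r k (n1 + n2 - k) = real (card E1) - baseline r k n1
      + (real (card E2) - baseline r k n2) + (real (k choose r) - real (card (E1 \<inter> Pow S)))"
    by linarith
  have uni: "uniform_hypergraph r (V1 \<union> V2) E"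
    unfolding uniform_hypergraph_def
  proof (intro conjI ballI)
    fix e assume "e \<in> E"
    then show "e \<subseteq> V1 \<union> V2" "card e = r"
      using fin1(4,5) fin2(4,5) by (auto simp: E_def M_def meeting_sets_def)
  qed (use fin1 fin2 in auto)
  \<comment> \<open>No side acquires new edges: added sets lie in neither side, and an edge of
    \<open>E2\<close> inside \<open>V1\<close> lies in \<open>S\<close>, where both hypergraphs
    agree.\<close>
  have E_V1: "e \<in> E1" if "e \<in> E" "e \<subseteq> V1" for e
    using that fin2(4)[of e] agree S(1) by (auto simp: E_def M_def)
  have E_V2: "e \<in> E2" if "e \<in> E" "e \<subseteq> V2" for e
    using that fin1(4)[of e] agree S(1) by (auto simp: E_def M_def)
  have False if sub: "hyper_subgraph r V' E' (V1 \<union> V2) E" and con: "Suc_connected k V' E'"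
    and big: "real (card V') > c * real k + real k" for V' E'
  proof -
    have V': "V' \<subseteq> V1 \<union> V2" and E': "E' \<subseteq> E" and E'V': "\<And>e. e \<in> E' \<Longrightarrow> e \<subseteq> V'"
      and uni': "uniform_hypergraph r V' E'" and "finite V'"
      using sub by (auto simp: hyper_subgraph_def uniform_hypergraph_def)
    consider "V' \<subseteq> V1" | "V' \<subseteq> V2" | "V' - V2 \<noteq> {}" "V' - V1 \<noteq> {}" by blast
    then show False
    proof cases
      case 1
      then have "E' \<subseteq> E1" using E_V1 E' E'V' by blast
      then have "hyper_subgraph r V' E' V1 E1" using uni' 1 by (simp add: hyper_subgraph_def)
      with VE1 con big show False unfolding hyper_family_def by blast
    next
      case 2
      then have "E' \<subseteq> E2" using E_V2 E' E'V' by blast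
      then have "hyper_subgraph r V' E' V2 E2" using uni' 2 by (simp add: hyper_subgraph_def)
      with VE2 con big show False unfolding hyper_family_def by blast
    next
      case 3
      have "finite S" using S fin1(1) by auto
      have "\<not> Suc_connected k V' E'"
      proof (rule separated_not_Suc_connected)
        show "V' = (V' \<inter> S) \<union> (V' - V2) \<union> (V' - V1)" using V' S(1) by auto
        show "card (V' \<inter> S) \<le> k" using S(2) \<open>finite S\<close> card_mono[of S "V' \<inter> S"] by auto
        fix e assume e: "e \<in> E'" "e \<inter> (V' \<inter> S) = {}"
        then have "e \<inter> S = {}" using E'V' by blast
        with e E' have "e \<in> E1 \<or> e \<in> E2" by (auto simp: E_def M_def meeting_sets_def)
        then have "e \<subseteq> V1 \<or> e \<subseteq> V2" using fin1(4) fin2(4) by blast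
        with E'V'[OF e(1)] \<open>e \<inter> S = {}\<close> S(1) show "e \<subseteq> V' - V2 \<or> e \<subseteq> V' - V1" by blast
      qed (use 3 S(1) V' \<open>finite V'\<close> in auto)
      with con show False by simp
    qed
  qed
  then have "(V1 \<union> V2, E) \<in> hyper_family c r (n1 + n2 - k) k"
    using uni cardV by (auto simp: hyper_family_def)
  moreover have "E \<inter> Pow S = E1 \<inter> Pow S"
    using agree S(1) by (auto simp: E_def M_def)
  ultimately show thesis using that count by blast
qed

text \<open>\<open>S\<close> is fixed pointwise and every other vertex is shifted beyond all of
  \<open>W \<union> V\<close>.\<close>

lemma fresh_copy:
  assumes VE: "(V, E) \<in> hyper_family c r n k" and S: "S \<subseteq> V" "S \<subseteq> W" and "finite W"
  obtains V' E' where "(V', E') \<in> hyper_family c r n k" "W \<inter> V' = S"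
    "E' \<inter> Pow S = E \<inter> Pow S" "card E' = card E"
proof -
  note fin = hyper_family_finite[OF VE]
  define N where "N = Suc (Max (W \<union> V))"
  define f where "f = (\<lambda>v. if v \<in> S then v else v + N)"
  have less: "v < N" if "v \<in> W \<union> V" for v
    using Max_ge[of "W \<union> V" v] fin(1) \<open>finite W\<close> that by (simp add: N_def le_imp_less_Suc)
  have f_S: "f v \<in> W \<longleftrightarrow> v \<in> S" for v
    using S less[of "v + N"] by (auto simp: f_def)
  have inj: "inj_on f V"
    using S less by (fastforce simp: inj_on_def f_def split: if_splits)
  have fix_S: "f ` e = e" if "e \<subseteq> S" for e
  proof -
    have "f ` e = id ` e" using that by (intro image_cong) (auto simp: f_def)
    then show ?thesis by simp
  qed
  show thesis
  proof (rule that)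
    show "(f ` V, (`) f ` E) \<in> hyper_family c r n k" using inj VE by (rule hyper_family_image)
    show "W \<inter> f ` V = S"
    proof
      show "W \<inter> f ` V \<subseteq> S"
      proof clarify
        fix x assume "f x \<in> W"
        then have "x \<in> S" by (simp only: f_S)
        then show "f x \<in> S" by (simp add: f_def)
      qed
      show "S \<subseteq> W \<inter> f ` V" using S by (force simp: f_def)
    qed
    have sub: "e \<subseteq> S" if "f ` e \<subseteq> S" for e
      using that f_S S(2) by blast
    show "(`) f ` E \<inter> Pow S = E \<inter> Pow S"
    proof (intro equalityI subsetI)
      fix e assume "e \<in> (`) f ` E \<inter> Pow S"
      then obtain e0 where e0: "e0 \<in> E" "e = f ` e0" "e0 \<subseteq> S" using sub by blast
      then have "e = e0" by (simp only: fix_S)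
      with e0 show "e \<in> E \<inter> Pow S" by simp
    next
      fix e assume "e \<in> E \<inter> Pow S"
      then have e: "e \<in> E" "e \<subseteq> S" by auto
      from imageI[OF e(1), of "(`) f"] have "e \<in> (`) f ` E" by (simp only: fix_S[OF e(2)])
      with e show "e \<in> (`) f ` E \<inter> Pow S" by simp
    qed
    show "card ((`) f ` E) = card E"
      using inj_on_image_Pow[OF inj] fin(4) by (intro card_image) (auto intro: inj_on_subset)
  qed
qed

text \<open>The glued piece lives on \<open>S\<close> and a new vertex w, with all r-sets through w
  as edges; its k + 1 vertices are too few for (k+1)-connectedness. Its surplus lacks exactly the
  non-edges inside \<open>S\<close>, which cancels the gain from gluing.\<close>

lemma add_vertex:
  assumes VE: "(V, E) \<in> hyper_family c r n k" and S: "S \<subseteq> V" "card S = k" and "r \<ge> 2"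
  obtains V' E' where "(V', E') \<in> hyper_family c r (n + 1) k" "S \<subseteq> V'" "E' \<inter> Pow S = E \<inter> Pow S"
    "real (card E') - baseline r k (n + 1) = real (card E) - baseline r k n"
proof -
  note fin = hyper_family_finite[OF VE]
  have finS: "finite S" using S fin by (auto intro: finite_subset)
  obtain w where w: "w \<notin> V" using ex_new_if_finite[OF infinite_UNIV_nat fin(1)] by blast
  define V2 where "V2 = insert w S"
  let ?N = "\<lambda>X. {e. e \<subseteq> X \<and> card e = r}"
  define E2 where "E2 = (E \<inter> Pow S) \<union> (?N V2 - ?N S)"
  have "w \<notin> S" using w S by auto
  then have cardV2: "card V2 = k + 1" using S finS by (simp add: V2_def)
  have "uniform_hypergraph r V2 E2"
    using finS fin(5) by (auto simp: uniform_hypergraph_def E2_def V2_def)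
  moreover have "\<not> Suc_connected k V' E'" if "V' \<subseteq> V2" for V' E'
    using card_mono[of V2 V'] that cardV2 finS by (auto simp: Suc_connected_def V2_def)
  ultimately have VE2: "(V2, E2) \<in> hyper_family c r (k + 1) k"
    using cardV2 by (auto simp: hyper_family_def hyper_subgraph_def)
  have E2S: "E \<inter> Pow S = E2 \<inter> Pow S" by (auto simp: E2_def)
  have finN: "finite (?N V2)" by (rule finite_subset[of _ "Pow V2"]) (use finS in \<open>auto simp: V2_def\<close>)
  have "card E2 = card (E \<inter> Pow S) + card (?N V2 - ?N S)"
    unfolding E2_def using fin finN by (intro card_Un_disjoint) auto
  moreover have "?N S \<subseteq> ?N V2" by (auto simp: V2_def)
  then have "card (?N V2 - ?N S) = card (?N V2) - card (?N S)" "card (?N S) \<le> card (?N V2)"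
    using finN by (auto intro: card_Diff_subset card_mono finite_subset)
  moreover have "card (?N V2) = (k + 1) choose r" "card (?N S) = k choose r"
    using cardV2 finS S(2) n_subsets[of V2 r] n_subsets[of S r] by (auto simp: V2_def)
  \<comment> \<open>The subtracted term is \<open>1 choose r\<close>, which vanishes because r \<ge>
    2.\<close>
  moreover have "baseline r k (k + 1) = real ((k + 1) choose r)"
    using \<open>r \<ge> 2\<close> by (simp add: baseline_def binomial_eq_0)
  ultimately have count2: "real (card E2) - baseline r k (k + 1)
      = real (card (E \<inter> Pow S)) - real (k choose r)" by simp
  have int: "V \<inter> V2 = S" using w S by (auto simp: V2_def)
  obtain E' where E': "(V \<union> V2, E') \<in> hyper_family c r (n + (k + 1) - k) k"
    "E' \<inter> Pow S = E \<inter> Pow S"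
    "real (card E') - baseline r k (n + (k + 1) - k) = real (card E) - baseline r k n
      + (real (card E2) - baseline r k (k + 1)) + (real (k choose r) - real (card (E \<inter> Pow S)))"
    by (rule glue_hypergraphs[OF VE VE2 int S(2) E2S]) (use \<open>r \<ge> 2\<close> in auto)
  show thesis
    by (rule that[of "V \<union> V2" E']) (use E' count2 S in auto)
qed

text \<open>Glue \<open>Suc p\<close> copies of one extremal hypergraph along a common k-set, each
  gluing losing nothing, then add q vertices one by one. The form with a remainder q fits division
  of an arbitrary size by m.\<close>

lemma surplus_superadditive:
  assumes "r \<ge> 2"
  shows "real (Suc p) * surplus c r (m + k) k \<le> surplus c r (Suc p * m + q + k) k"
proof -
  obtain V1 E1 where VE1: "(V1, E1) \<in> hyper_family c r (m + k) k"
    and s1: "surplus c r (m + k) k = real (card E1) - baseline r k (m + k)" by (rule surplus_attained)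
  note fin1 = hyper_family_finite[OF VE1]
  obtain S where S: "S \<subseteq> V1" "card S = k" "finite S"
    using obtain_subset_with_card_n[of k V1] fin1 by (metis le_add2)
  have "card (E1 \<inter> Pow S) \<le> card {e. e \<subseteq> S \<and> card e = r}"
    using fin1(5) S(3) by (intro card_mono) auto
  then have gain: "card (E1 \<inter> Pow S) \<le> k choose r" using S by (simp add: n_subsets)
  have copies: "\<exists>V E. (V, E) \<in> hyper_family c r (Suc p * m + k) k \<and> S \<subseteq> V \<and>
      E \<inter> Pow S = E1 \<inter> Pow S \<and>
      real (card E) - baseline r k (Suc p * m + k) \<ge> real (Suc p) * surplus c r (m + k) k"
  proof (induction p)
    case 0
    then show ?case using VE1 S s1 by auto
  next
    case (Suc p)
    then obtain V E where VE: "(V, E) \<in> hyper_family c r (Suc p * m + k) k" "S \<subseteq> V"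
      "E \<inter> Pow S = E1 \<inter> Pow S"
      "real (card E) - baseline r k (Suc p * m + k) \<ge> real (Suc p) * surplus c r (m + k) k"
      by blast
    obtain V2 E2 where VE2: "(V2, E2) \<in> hyper_family c r (m + k) k" "V \<inter> V2 = S"
      "E2 \<inter> Pow S = E1 \<inter> Pow S" "card E2 = card E1"
      using fresh_copy[OF VE1 S(1) VE(2)] hyper_family_finite(1)[OF VE(1)] by metis
    have agree: "E \<inter> Pow S = E2 \<inter> Pow S" using VE(3) VE2(3) by simp
    have n: "Suc p * m + k + (m + k) - k = Suc (Suc p) * m + k" by simp
    obtain E' where "(V \<union> V2, E') \<in> hyper_family c r (Suc (Suc p) * m + k) k"
      "E' \<inter> Pow S = E \<inter> Pow S"
      "real (card E') - baseline r k (Suc (Suc p) * m + k) =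
        real (card E) - baseline r k (Suc p * m + k) + (real (card E2) - baseline r k (m + k))
        + (real (k choose r) - real (card (E \<inter> Pow S)))"
      using glue_hypergraphs[OF VE(1) VE2(1,2) S(2) agree, unfolded n] \<open>r \<ge> 2\<close> by auto
    moreover have "real (Suc (Suc p)) * surplus c r (m + k) k
        = real (Suc p) * surplus c r (m + k) k + surplus c r (m + k) k"
      by (simp add: algebra_simps)
    ultimately show ?case
      using VE VE2 gain s1 by (intro exI[of _ "V \<union> V2"] exI[of _ E']) auto
  qed
  have "\<exists>V E. (V, E) \<in> hyper_family c r (Suc p * m + q + k) k \<and> S \<subseteq> V \<and>
      real (card E) - baseline r k (Suc p * m + q + k) \<ge> real (Suc p) * surplus c r (m + k) k"
  proof (induction q)
    case 0
    then show ?case using copies by auto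
  next
    case (Suc q)
    then obtain V E where VE: "(V, E) \<in> hyper_family c r (Suc p * m + q + k) k" "S \<subseteq> V"
      "real (card E) - baseline r k (Suc p * m + q + k) \<ge> real (Suc p) * surplus c r (m + k) k"
      by blast
    have n: "Suc p * m + q + k + 1 = Suc p * m + Suc q + k" by simp
    obtain V' E' where "(V', E') \<in> hyper_family c r (Suc p * m + Suc q + k) k" "S \<subseteq> V'"
      "real (card E') - baseline r k (Suc p * m + Suc q + k)
        = real (card E) - baseline r k (Suc p * m + q + k)"
      using add_vertex[OF VE(1,2) S(2) \<open>r \<ge> 2\<close>, unfolded n] by metis
    with VE(3) show ?case by (intro exI[of _ V'] exI[of _ E']) auto
  qed
  then show ?thesis using surplus_ge by (meson order_trans)
qed

section \<open>Fekete's argument and the limit\<close>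

text \<open>The limit is the supremum of the quotients: a quotient close to it at m is nearly
  attained at every large n, by writing n as a multiple of m plus a remainder.\<close>

lemma superadditive_convergent:
  fixes u :: "nat \<Rightarrow> real"
  assumes super: "\<And>p m q. real (Suc p) * u m \<le> u (Suc p * m + q)"
    and bound: "\<And>m. m \<ge> N \<Longrightarrow> u m \<le> B * real m"
  shows "convergent (\<lambda>m. u m / real m)"
proof -
  define X where "X = (\<lambda>m. u m / real m)"
  \<comment> \<open>The bound beyond \<open>N\<close> spreads to every m \<ge> 1 by passing to the
    multiple \<open>Suc N * m\<close>.\<close>
  have X_le: "X m \<le> B" if "m \<ge> 1" for m
  proof -
    have "N * 1 \<le> Suc N * m" using that by (intro mult_mono) auto
    then have "real (Suc N) * u m \<le> real (Suc N) * (B * real m)"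
      using super[of N m 0] bound[of "Suc N * m"] by (simp add: algebra_simps)
    then have "u m \<le> B * real m" by (simp only: mult_le_cancel_left_pos of_nat_0_less_iff zero_less_Suc)
    then show ?thesis using that by (simp add: X_def pos_divide_le_eq)
  qed
  define L where "L = (SUP m\<in>{1..}. X m)"
  have bdd: "bdd_above (X ` {1..})" using X_le by (intro bdd_aboveI2[of _ _ B]) auto
  have "X \<longlonglongrightarrow> L"
  proof (rule LIMSEQ_I)
    fix e :: real assume "e > 0"
    have "L - e / 2 < L" using \<open>e > 0\<close> by simp
    then obtain m where m: "m \<ge> 1" "L - e / 2 < X m"
      unfolding L_def using less_cSUP_iff[OF _ bdd, of "L - e / 2"] by (auto simp: L_def)
    \<comment> \<open>From \<open>n0\<close> on, the remainder costs at most m |X m|, less than n e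
      / 2; the other e / 2 is the distance of \<open>X m\<close> from the supremum.\<close>
    obtain n0 where n0: "real n0 > 2 * real m * \<bar>X m\<bar> / e" using reals_Archimedean2 by blast
    have "norm (X n - L) < e" if n: "n \<ge> max m (max 1 n0)" for n
    proof -
      have "n div m \<ge> 1" using n m by (simp add: div_greater_zero_iff Suc_leI)
      then obtain p where p: "n div m = Suc p" by (cases "n div m") auto
      define q where "q = n mod m"
      have nq: "n = Suc p * m + q" using p by (metis div_mult_mod_eq q_def)
      have "q \<le> m" using m by (simp add: q_def less_imp_le)
      have um: "u m = real m * X m" using m by (simp add: X_def)
      have un: "u n = real n * X n" using n by (simp add: X_def)
      have "real q * X m \<le> real q * \<bar>X m\<bar>" by (intro mult_left_mono) auto
      also have "\<dots> \<le> real m * \<bar>X m\<bar>"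
        using \<open>q \<le> m\<close> by (intro mult_right_mono) auto
      finally have "real q * X m \<le> real m * \<bar>X m\<bar>" .
      moreover have "real (Suc p) * real m * X m = real n * X m - real q * X m"
        by (subst nq) (simp add: algebra_simps)
      moreover have "real (Suc p) * u m \<le> u n" using super[of p m q] nq by simp
      moreover have "2 * real m * \<bar>X m\<bar> < e * real n"
      proof -
        have "2 * real m * \<bar>X m\<bar> < e * real n0" using n0 \<open>e > 0\<close> by (simp add: pos_divide_less_eq mult.commute)
        also have "\<dots> \<le> e * real n" using n \<open>e > 0\<close> by (intro mult_left_mono) auto
        finally show ?thesis .
      qed
      ultimately have "real n * X m - e * real n / 2 < real n * X n"
        unfolding um un by (simp add: mult.assoc)
      then have "real n * (X m - e / 2) < real n * X n" by (simp add: algebra_simps)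
      then have "X m - e / 2 < X n" by (simp add: mult_less_cancel_left)
      moreover have "X n \<le> L" unfolding L_def using n by (intro cSUP_upper bdd) auto
      ultimately show ?thesis using m by simp
    qed
    then show "\<exists>no. \<forall>n\<ge>no. norm (X n - L) < e" by blast
  qed
  then show ?thesis unfolding X_def by (rule convergentI)
qed

theorem theorem1p3:
  fixes k r :: nat and c :: real
  assumes "k \<ge> r" and "r \<ge> 3" and "c \<ge> 1"
  shows "(\<forall>n::nat. real n \<ge> (2 ^ r * c / (2 ^ r - 1) + 1) * real k \<longrightarrow>
            rel_surplus c r n k
              \<le> c ^ (r - 1) + (1 / c) * (1 - 1 / (2 ^ (r + 1) - 2))
                  - real k / (real n - real k))
         \<and> lim_rel_surplus c r k \<le> c ^ (r - 1) + (1 / c) * (1 - 1 / (2 ^ (r + 1) - 2))"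
proof -
  define G where "G = c ^ (r - 1) + (1 / c) * (1 - 1 / (2 ^ (r + 1) - 2))"
  define t0 where "t0 = 2 ^ r * c / (2 ^ r - 1)"
  \<comment> \<open>With n = m + k, \<open>u m / real m\<close> is the relative surplus, so Fekete's
    argument runs in the number of vertices outside the separator.\<close>
  define u where "u = (\<lambda>m. fact r * surplus c r (m + k) k / real k ^ (r - 1))"
  have k: "k > 0" using assms by simp
  have "(2::real) ^ r > 1" using assms by (intro one_less_power) auto
  then have "t0 > 0" using assms by (simp add: t0_def)
  have kr: "real k ^ r = real k * real k ^ (r - 1)"
    using assms by (metis power_eq_if not_numeral_le_zero)
  have rel: "rel_surplus c r (m + k) k = u m / real m" for m
    by (simp add: rel_surplus_def u_def)
  have "c * real k \<ge> 1 * 1" using assms k by (intro mult_mono) auto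
  have u_le: "u m \<le> G * real m - real k" if "real m \<ge> t0 * real k" for m
  proof -
    have "u m / real k \<le> G * (real m / real k) - 1"
      using surplus_bound[of k r c m] that assms k \<open>c * real k \<ge> 1 * 1\<close>
      by (simp add: G_def t0_def u_def kr mult.commute)
    then show ?thesis using k by (simp add: field_simps)
  qed
  have bound: "rel_surplus c r n k \<le> G - real k / (real n - real k)"
    if n: "real n \<ge> (t0 + 1) * real k" for n
  proof -
    have m: "real n - real k \<ge> t0 * real k" using n by (simp add: algebra_simps)
    moreover have "t0 * real k > 0" using \<open>t0 > 0\<close> k by simp
    ultimately have "real n > real k" by linarith
    then obtain m where nm: "n = m + k" "m > 0"
      by (metis add.commute less_imp_add_positive of_nat_less_iff)
    with u_le[of m] m have "u m \<le> G * real m - real k" by simp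
    with nm show ?thesis by (simp add: rel pos_divide_le_eq left_diff_distrib)
  qed
  \<comment> \<open>Beyond \<open>N\<close> the explicit bound applies both to \<open>u m\<close>
    with m \<ge> N and to the relative surplus with n \<ge> N.\<close>
  obtain N where N: "real N > (t0 + 1) * real k" using reals_Archimedean2 by blast
  have "convergent (\<lambda>m. u m / real m)"
  proof (rule superadditive_convergent)
    show "real (Suc p) * u m \<le> u (Suc p * m + q)" for p m q
      using surplus_superadditive[of r p c m k q] assms k
      by (simp add: u_def divide_right_mono mult.left_commute[of _ "fact r"] mult_left_mono)
    show "u m \<le> G * real m" if "m \<ge> N" for m
      using u_le[of m] N that k by (simp add: algebra_simps)
  qed
  then obtain L where "(\<lambda>m. rel_surplus c r (m + k) k) \<longlonglongrightarrow> L"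
    by (auto simp: rel convergent_def)
  then have L: "(\<lambda>n. rel_surplus c r n k) \<longlonglongrightarrow> L" by (rule LIMSEQ_offset)
  have "rel_surplus c r n k \<le> G" if "n \<ge> N" for n
  proof -
    have n: "real n \<ge> (t0 + 1) * real k" using N that by linarith
    moreover have "real n \<ge> real k"
      using n \<open>t0 > 0\<close> k by (smt (verit) mult_le_cancel_right1 of_nat_0_less_iff)
    ultimately show ?thesis using bound[of n] by (smt (verit) divide_nonneg_nonneg of_nat_0_le_iff)
  qed
  then have "L \<le> G" by (intro LIMSEQ_le_const2[OF L]) blast
  then have "lim_rel_surplus c r k \<le> G" using limI[OF L] by (simp add: lim_rel_surplus_def)
  with bound show ?thesis by (auto simp: G_def t0_def)
qed

end
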